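(* Let $f(x)=ax^2+bx+c$ be a polynomial with integer coefficients $a,b,c\in\mathbb{Z}$ and $a\neq 0$. Then $f(x)$ can be factorized over $\mathbb{Z}$ as a product of two linear polynomials if and only if there exist $p,q\in\mathbb{Z}$ such that $pq=ac$ and $p+q=b$. In this case (that is, whenever $p,q\in\mathbb{Z}$ satisfy $pq=ac$ and $p+q=b$), the roots of $f(x)$ are $-\dfrac{p}{a}$ and $-\dfrac{q}{a}$.
   Context: "$f$ can be factorized over $\mathbb{Z}$ in two linear polynomials" means that there are two polynomials of degree one with integer coefficients whose product is $f$, i.e. $f(x)=(p_1x+p_2)(q_1x+q_2)$ with $p_1,p_2,q_1,q_2\in\mathbb{Z}$ and $p_1,q_1\neq 0$. Roots are listed with multiplicity. *)

theory Defs
  imports Complex_Main "HOL-Computational_Algebra.Polynomial"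
begin

end

theory Submission
  imports Defs
begin

text \<open>Splitting the middle term: with \<open>d = gcd a p\<close>, \<open>a = d a'\<close> and \<open>p = d p'\<close>, the equation
  \<open>p q = a c\<close> forces \<open>q = a' q'\<close> and \<open>c = p' q'\<close>, so that \<open>a x^2 + b x + c = (a' x + p') (d x + q')\<close>.\<close>

lemma factor_quadratic_int:
  fixes a c p q :: int
  assumes "a \<noteq> 0" and pq: "p * q = a * c"
  obtains g h :: "int poly"
  where "degree g = 1" "degree h = 1" "[:c, p + q, a:] = g * h"
proof -
  define d where "d = gcd a p"
  have d: "d \<noteq> 0"
    using \<open>a \<noteq> 0\<close> by (simp add: d_def)
  obtain a' p' where ap: "a = a' * d" "p = p' * d" "coprime a' p'"
    using gcd_coprime_exists[of a p] d unfolding d_def by blast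
  have a': "a' \<noteq> 0"
    using ap \<open>a \<noteq> 0\<close> by auto
  have p'q: "p' * q = a' * c"
    using pq d by (simp add: ap algebra_simps)
  \<comment> \<open>Cancelling \<open>d\<close> has left \<open>a'\<close> dividing
    \<open>p' * q\<close>; being coprime to \<open>p'\<close>, it must divide the other
    factor.\<close>
  then have "a' dvd q"
    using ap(3) by (metis coprime_dvd_mult_right_iff dvd_triv_left)
  then obtain q' where q: "q = a' * q'" ..
  have c: "c = p' * q'"
    using p'q a' by (simp add: q)
  show thesis
  proof
    show "degree [:p', a':] = 1" "degree [:q', d:] = 1"
      using a' d by simp_all
    show "[:c, p + q, a:] = [:p', a':] * [:q', d:]"
      by (simp add: ap q c algebra_simps)
  qed
qed

text \<open>After division by \<open>a\<close>, the equation \<open>p * q = a * c\<close> turns the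
  constant term c/a into (p/a)(q/a), so the monic quadratic splits as (x + p/a)(x + q/a). The
  multiset counts a double root twice when \<open>p = q\<close>.\<close>

lemma proots_quadratic:
  fixes a c p q :: "'a::field"
  assumes "a \<noteq> 0" and "p * q = a * c"
  shows "proots [:c, p + q, a:] = {# - (p / a), - (q / a) #}"
proof -
  have "[:c, p + q, a:] = smult a ([:p / a, 1:] * [:q / a, 1:])"
    using assms by (simp add: field_simps)
  \<comment> \<open>The product must stay unexpanded for \<open>proots_mult\<close> to apply, hence
    the deleted simp rules.\<close>
  also have "proots \<dots> = proots [:p / a, 1:] + proots [:q / a, 1:]"
    using \<open>a \<noteq> 0\<close> by (simp add: proots_mult del: mult_pCons_left mult_pCons_right)
  also have "\<dots> = {# - (p / a), - (q / a) #}"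
    by simp
  finally show ?thesis .
qed

theorem theorem1:
  fixes a b c :: int and f :: "int poly"
  assumes "a \<noteq> 0"
    and "f = [:c, b, a:]"
  shows "((\<exists>g h :: int poly. degree g = 1 \<and> degree h = 1 \<and> f = g * h)
            \<longleftrightarrow> (\<exists>p q :: int. p * q = a * c \<and> p + q = b))
       \<and> (\<forall>p q :: int. p * q = a * c \<and> p + q = b \<longrightarrow>
            proots (map_poly of_int f :: complex poly)
              = {# - (of_int p / of_int a), - (of_int q / of_int a) #})"
proof (intro conjI iffI allI impI)
  assume "\<exists>g h :: int poly. degree g = 1 \<and> degree h = 1 \<and> f = g * h"
  then obtain g h :: "int poly" where "degree g = 1" "degree h = 1" and f: "f = g * h"
    by blast
  then obtain r s t u where "g = [:s, r:]" "h = [:u, t:]"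
    by (metis degree1_coeffs)
  then have "c = s * u" "b = s * t + r * u" "a = r * t"
    using f \<open>f = [:c, b, a:]\<close> by (simp_all add: algebra_simps)
  \<comment> \<open>The witnesses are the two cross terms of (r x + s)(t x + u): their sum is the
    middle coefficient, and their product regroups as (r t)(s u).\<close>
  then have "(s * t) * (r * u) = a * c" "s * t + r * u = b"
    by (simp_all add: algebra_simps)
  then show "\<exists>p q. p * q = a * c \<and> p + q = b"
    by blast
next
  assume "\<exists>p q. p * q = a * c \<and> p + q = b"
  then show "\<exists>g h :: int poly. degree g = 1 \<and> degree h = 1 \<and> f = g * h"
    using assms factor_quadratic_int by metis
next
  fix p q
  assume pq: "p * q = a * c \<and> p + q = b"
  \<comment> \<open>The integer relations are carried into the complex numbers, where division by
    \<open>a\<close> makes sense.\<close>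
  then have "of_int p * of_int q = (of_int a * of_int c :: complex)"
    by (metis of_int_mult)
  moreover have "map_poly of_int f = [:of_int c, of_int p + of_int q, of_int a :: complex:]"
    using assms pq by (auto simp: map_poly_pCons)
  ultimately show "proots (map_poly of_int f :: complex poly)
      = {# - (of_int p / of_int a), - (of_int q / of_int a) #}"
    using \<open>a \<noteq> 0\<close> proots_quadratic[of "of_int a :: complex" "of_int p" "of_int q" "of_int c"]
    by simp
qed

end
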